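(* Let $c:\mathbb{X}\times\mathbb{U}\to\mathbb{R}$ be bounded and continuous on $\mathbb{X}\times\mathbb{U}$, let $\mathbb{U}$ be compact, and let the channel $Q$ be continuous in total variation, i.e. $\|Q(\cdot|x_n)-Q(\cdot|x)\|_{TV}\to0$ whenever $x_n\to x$ in $\mathbb{X}$. If $P_n\to P$ weakly in $\mathcal{P}(\mathbb{X})$, then $J^*(P_n,Q)\to J^*(P,Q)$.
   Context: $\mathbb{X}\subset\mathbb{R}^n$, $\mathbb{Y}\subset\mathbb{R}^m$ and $\mathbb{U}$ (a subset of some Euclidean space) are Borel sets; $\mathcal{P}(\mathbb{X})$ is the set of Borel probability measures on $\mathbb{X}$. A channel $Q$ is a stochastic kernel from $\mathbb{X}$ to $\mathbb{Y}$. $\Gamma$ is the set of Borel measurable functions $\gamma:\mathbb{Y}\to\mathbb{U}$. Define $$J(P,Q,\gamma)=\int_{\mathbb{X}}\int_{\mathbb{Y}}c(x,\gamma(y))\,Q(dy|x)\,P(dx),\qquad J^*(P,Q)=\inf_{\gamma\in\Gamma}J(P,Q,\gamma).$$ The total variation distance is $\|\mu-\nu\|_{TV}=2\sup_B|\mu(B)-\nu(B)|$, the supremum being over Borel sets. *)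

theory Defs
  imports "HOL-Probability.Probability"
begin

text \<open>
  A Borel set \<open>X\<close> carries the trace \<open>\<sigma>\<close>-algebra, so a Borel probability measure on \<open>X\<close> lives
  on \<open>restrict_space borel X\<close>. The space of these measures has the evaluation \<open>\<sigma>\<close>-algebra of
  \<open>prob_algebra\<close>, so measurability into it is measurability of \<open>x \<mapsto> Q(B|x)\<close> for each Borel \<open>B\<close>.
\<close>

abbreviation borel_on :: "'a::topological_space set \<Rightarrow> 'a measure" where
  "borel_on X \<equiv> restrict_space borel X"

definition prob_measures :: "'a::topological_space set \<Rightarrow> 'a measure set" where
  "prob_measures X = {P. prob_space P \<and> sets P = sets (borel_on X)}"

definition channels ::
  "'a::topological_space set \<Rightarrow> 'b::topological_space set \<Rightarrow> ('a \<Rightarrow> 'b measure) set" where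
  "channels X Y = borel_on X \<rightarrow>\<^sub>M prob_algebra (borel_on Y)"

definition policies ::
  "'b::topological_space set \<Rightarrow> 'u::topological_space set \<Rightarrow> ('b \<Rightarrow> 'u) set" where
  "policies Y U = borel_on Y \<rightarrow>\<^sub>M borel_on U"

definition cost ::
  "('a \<Rightarrow> 'u \<Rightarrow> real) \<Rightarrow> 'a measure \<Rightarrow> ('a \<Rightarrow> 'b measure) \<Rightarrow> ('b \<Rightarrow> 'u) \<Rightarrow> real" where
  "cost c P Q \<gamma> = (\<integral>x. (\<integral>y. c x (\<gamma> y) \<partial>Q x) \<partial>P)"

text \<open>
  For bounded \<open>c\<close> the real infimum is over a bounded set. If there are no policies (\<open>U\<close> empty), it is
  the fixed real number \<open>Inf {}\<close>, in place of the conventional \<open>\<infinity>\<close>; it is independent of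
  \<open>P\<close> and \<open>Q\<close> under either convention.
\<close>

definition opt_cost ::
  "'b::topological_space set \<Rightarrow> 'u::topological_space set \<Rightarrow> ('a \<Rightarrow> 'u \<Rightarrow> real) \<Rightarrow>
    'a measure \<Rightarrow> ('a \<Rightarrow> 'b measure) \<Rightarrow> real" where
  "opt_cost Y U c P Q = (INF \<gamma>\<in>policies Y U. cost c P Q \<gamma>)"

text \<open>Only meaningful for two probability measures on the same \<open>\<sigma>\<close>-algebra.\<close>

definition tv_dist :: "'b measure \<Rightarrow> 'b measure \<Rightarrow> real" where
  "tv_dist \<mu> \<nu> = 2 * (SUP B\<in>sets \<mu>. \<bar>measure \<mu> B - measure \<nu> B\<bar>)"

definition tv_continuous :: "'a::topological_space set \<Rightarrow> ('a \<Rightarrow> 'b measure) \<Rightarrow> bool" where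
  "tv_continuous X Q \<longleftrightarrow>
    (\<forall>xs x. (\<forall>n. xs n \<in> X) \<and> x \<in> X \<and> xs \<longlonglongrightarrow> x \<longrightarrow> (\<lambda>n. tv_dist (Q (xs n)) (Q x)) \<longlonglongrightarrow> 0)"

text \<open>The library's \<open>weak_conv_m\<close> covers only measures on the real line.\<close>

definition weakly_converges ::
  "'a::topological_space set \<Rightarrow> (nat \<Rightarrow> 'a measure) \<Rightarrow> 'a measure \<Rightarrow> bool" where
  "weakly_converges X Ps P \<longleftrightarrow>
    (\<forall>f :: 'a \<Rightarrow> real. continuous_on X f \<and> bounded (f ` X) \<longrightarrow>
      (\<lambda>n. \<integral>x. f x \<partial>Ps n) \<longlonglongrightarrow> (\<integral>x. f x \<partial>P))"

end

theory Submission
  imports Defs "HOL-Real_Asymp.Real_Asymp"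
begin

text \<open>
  The functions \<open>x \<mapsto> \<integral> c(x, \<gamma>(y)) Q(dy|x)\<close>, with \<open>\<gamma>\<close> ranging over all policies, are
  uniformly bounded, and they are equicontinuous: compactness of \<open>U\<close> controls the change of \<open>c\<close>
  uniformly in the action, and total variation continuity controls the change of \<open>Q\<close> uniformly over
  bounded integrands. Weak convergence is uniform on such a family, because, off a set of small measure and up to \<open>\<epsilon>\<close>, each member
  is a combination, with bounded coefficients, of the same finitely many continuous bump functions.
  Hence the costs converge uniformly over the policies, and so do their infima.
\<close>

section \<open>Infima of uniformly close functions\<close>

text \<open>Either infimum, lowered by \<open>e\<close>, is a lower bound of the other function. The
  real \<open>INF\<close> is a true infimum only over a nonempty set of values bounded below, hence
  the first three assumptions.\<close>

lemma abs_diff_cINF_le: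
  fixes f g :: "'a \<Rightarrow> real"
  assumes "A \<noteq> {}" "bdd_below (f ` A)" "bdd_below (g ` A)"
    and fg: "\<And>x. x \<in> A \<Longrightarrow> \<bar>f x - g x\<bar> \<le> e"
  shows "\<bar>(INF x\<in>A. f x) - (INF x\<in>A. g x)\<bar> \<le> e"
proof -
  have "(INF x\<in>A. f x) - e \<le> (INF x\<in>A. g x)"
  proof (rule cINF_greatest)
    fix x assume "x \<in> A"
    with cINF_lower[OF assms(2) this] fg[OF this] show "(INF x\<in>A. f x) - e \<le> g x" by linarith
  qed fact
  moreover have "(INF x\<in>A. g x) - e \<le> (INF x\<in>A. f x)"
  proof (rule cINF_greatest)
    fix x assume "x \<in> A"
    with cINF_lower[OF assms(3) this] fg[OF this] show "(INF x\<in>A. g x) - e \<le> f x" by linarith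
  qed fact
  ultimately show ?thesis by linarith
qed

section \<open>Total variation and integrals of bounded functions\<close>

text \<open>The sum counts the positive integers up to \<open>t\<close>, so it equals the floor of
  \<open>t\<close>; the bound \<open>t \<le> real k\<close> ensures that none of them is cut off.
  This is the pointwise form of the decomposition into level sets.\<close>

lemma sum_of_bool_le_approx:
  fixes t :: real
  assumes "0 \<le> t" "t \<le> real k"
  shows "\<bar>t - (\<Sum>j=1..k. of_bool (real j \<le> t))\<bar> \<le> 1"
proof -
  have "{j \<in> {1..k}. real j \<le> t} = {1..nat \<lfloor>t\<rfloor>}"
    using assms by (auto simp: le_nat_floor) (linarith | simp add: le_nat_iff le_floor_iff)+
  then have "(\<Sum>j=1..k. of_bool (real j \<le> t)) = real (nat \<lfloor>t\<rfloor>)"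
    by (simp add: of_bool_def sum.If_cases Int_def)
  then show ?thesis using assms by linarith
qed

text \<open>Probabilities differ by at most 1, so the real supremum in \<open>tv_dist\<close> is
  over a bounded set and dominates each member.\<close>

lemma tv_dist_upper:
  assumes "prob_space \<mu>" "prob_space \<nu>" "sets \<mu> = sets \<nu>" "B \<in> sets \<mu>"
  shows "2 * \<bar>measure \<mu> B - measure \<nu> B\<bar> \<le> tv_dist \<mu> \<nu>"
proof -
  have "\<bar>measure \<mu> A - measure \<nu> A\<bar> \<le> 1" for A
    using prob_space.prob_le_1[OF assms(1), of A] prob_space.prob_le_1[OF assms(2), of A]
      measure_nonneg[of \<mu> A] measure_nonneg[of \<nu> A] by linarith
  then have "bdd_above ((\<lambda>A. \<bar>measure \<mu> A - measure \<nu> A\<bar>) ` sets \<mu>)"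
    by (intro bdd_aboveI2)
  from cSUP_upper[OF assms(4) this] show ?thesis unfolding tv_dist_def by simp
qed

lemma tv_dist_self: "tv_dist \<mu> \<mu> = 0"
  proof -
  have "sets \<mu> \<noteq> {}" using sets.empty_sets[of \<mu>] by blast
  then show ?thesis by (simp add: tv_dist_def)
qed

text \<open>
  Up to \<open>1/k\<close>, a function \<open>g\<close> into \<open>[0,1]\<close> is the average of the indicators of its level sets
  \<open>{g \<ge> j/k}\<close>, and \<open>tv_dist\<close> bounds the difference of the two measures on each of them.
\<close>

lemma abs_integral_diff_le_tv_dist_unit:
  assumes "prob_space \<mu>" "prob_space \<nu>" and sets_eq: "sets \<mu> = sets \<nu>"
    and g: "g \<in> borel_measurable \<mu>"
    and g01: "\<And>y. y \<in> space \<mu> \<Longrightarrow> 0 \<le> g y \<and> g y \<le> (1::real)"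
  shows "2 * \<bar>(\<integral>y. g y \<partial>\<mu>) - (\<integral>y. g y \<partial>\<nu>)\<bar> \<le> tv_dist \<mu> \<nu>"
proof -
  \<comment> \<open>The level set of \<open>g\<close> at height \<open>j/k\<close>, with the
    denominator cleared so that \<open>k = 0\<close> is harmless.\<close>
  define A where "A k j = {y \<in> space \<mu>. real j \<le> real k * g y}" for k j :: nat
  have A: "A k j \<in> sets \<mu>" for k j
    unfolding A_def using g by measurable
  \<comment> \<open>Scaled by \<open>k\<close>, the error stays at 1 for every \<open>k\<close>. The
    measure \<open>\<rho>\<close> will be both \<open>\<mu>\<close> and
    \<open>\<nu>\<close>.\<close>
  have layers: "\<bar>real k * (\<integral>y. g y \<partial>\<rho>) - (\<Sum>j=1..k. measure \<rho> (A k j))\<bar> \<le> 1"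
    if "prob_space \<rho>" and \<rho>: "sets \<rho> = sets \<mu>" for \<rho> k
  proof -
    interpret prob_space \<rho> by fact
    have sp: "space \<rho> = space \<mu>" using \<rho> by (rule sets_eq_imp_space_eq)
    have [measurable]: "g \<in> borel_measurable \<rho>" "\<And>j. A k j \<in> sets \<rho>"
      using g A \<rho> by (auto cong: measurable_cong_sets)
    have ig: "integrable \<rho> g"
      by (rule integrable_const_bound[where B=1]) (use g01 sp in auto)
    let ?h = "\<lambda>y. real k * g y - (\<Sum>j=1..k. indicator (A k j) y)"
    have bd: "\<bar>?h y\<bar> \<le> 1" if y: "y \<in> space \<rho>" for y
    proof -
      have "(\<Sum>j=1..k. indicator (A k j) y) = (\<Sum>j=1..k. of_bool (real j \<le> real k * g y) :: real)"
        using y sp by (intro sum.cong) (auto simp: A_def indicator_def)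
      then show ?thesis
        using sum_of_bool_le_approx[of "real k * g y" k] g01[of y] y sp
        by (simp add: mult_left_le)
    qed
    then have bd': "AE y in \<rho>. ?h y \<le> 1" "AE y in \<rho>. - 1 \<le> ?h y"
      by (intro AE_I2; force)+
    have "(\<integral>y. ?h y \<partial>\<rho>) = real k * (\<integral>y. g y \<partial>\<rho>) - (\<Sum>j=1..k. measure \<rho> (A k j))"
      using ig by (simp add: emeasure_eq_measure)
    moreover have "integrable \<rho> ?h"
      using ig by (simp add: emeasure_eq_measure)
    then have "(\<integral>y. ?h y \<partial>\<rho>) \<le> 1" "- 1 \<le> (\<integral>y. ?h y \<partial>\<rho>)"
      using bd' by (auto intro!: integral_le_const integral_ge_const)
    ultimately show ?thesis by linarith
  qed
  define D where "D = \<bar>(\<integral>y. g y \<partial>\<mu>) - (\<integral>y. g y \<partial>\<nu>)\<bar>"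
  have D: "real k * (2 * D - tv_dist \<mu> \<nu>) \<le> 4" for k
  proof -
    define s where "s \<rho> = (\<Sum>j=1..k. measure \<rho> (A k j))" for \<rho>
    have "\<bar>s \<mu> - s \<nu>\<bar> \<le> (\<Sum>j=1..k. \<bar>measure \<mu> (A k j) - measure \<nu> (A k j)\<bar>)"
      unfolding s_def by (simp only: sum_subtractf[symmetric] sum_abs)
    also have "\<dots> \<le> (\<Sum>j=1..k. tv_dist \<mu> \<nu> / 2)"
      using tv_dist_upper[OF assms(1-3) A] by (intro sum_mono) (simp add: field_simps)
    finally have 1: "2 * \<bar>s \<mu> - s \<nu>\<bar> \<le> real k * tv_dist \<mu> \<nu>"
      by simp
    have "real k * D = \<bar>real k * (\<integral>y. g y \<partial>\<mu>) - real k * (\<integral>y. g y \<partial>\<nu>)\<bar>"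
      by (simp add: D_def abs_mult right_diff_distrib[symmetric])
    \<comment> \<open>One unit of error for each of the two measures.\<close>
    then have 2: "real k * D \<le> \<bar>s \<mu> - s \<nu>\<bar> + 2"
      using layers[OF assms(1) refl, of k] layers[OF assms(2) sets_eq[symmetric], of k]
      unfolding s_def by linarith
    have "real k * (2 * D - tv_dist \<mu> \<nu>) = 2 * (real k * D) - real k * tv_dist \<mu> \<nu>"
      by (simp add: algebra_simps)
    also have "\<dots> \<le> 2 * (\<bar>s \<mu> - s \<nu>\<bar> + 2) - 2 * \<bar>s \<mu> - s \<nu>\<bar>"
      by (intro diff_mono mult_left_mono 1 2) simp
    finally show ?thesis by simp
  qed
  \<comment> \<open>The bound 4 does not depend on \<open>k\<close>, so a positive difference would
    contradict the Archimedean property.\<close>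
  have "\<not> 0 < 2 * D - tv_dist \<mu> \<nu>"
    using ex_less_of_nat_mult[of "2 * D - tv_dist \<mu> \<nu>" 4] D by (meson not_le)
  then show ?thesis by (simp add: D_def)
qed

text \<open>The affine map \<open>(g + M) / (2 * M)\<close> carries the range into the unit
  interval. Undoing it multiplies by \<open>2 * M\<close>, whose 2 cancels the factor 2 in
  \<open>tv_dist\<close>.\<close>

lemma abs_integral_diff_le_tv_dist:
  assumes "prob_space \<mu>" "prob_space \<nu>" and sets_eq: "sets \<mu> = sets \<nu>"
    and g: "g \<in> borel_measurable \<mu>"
    and M: "0 < M" "\<And>y. y \<in> space \<mu> \<Longrightarrow> \<bar>g y\<bar> \<le> (M::real)"
  shows "\<bar>(\<integral>y. g y \<partial>\<mu>) - (\<integral>y. g y \<partial>\<nu>)\<bar> \<le> M * tv_dist \<mu> \<nu>"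
proof -
  have I: "(\<integral>y. (g y + M) / (2 * M) \<partial>\<rho>) = ((\<integral>y. g y \<partial>\<rho>) + M) / (2 * M)"
    if "prob_space \<rho>" and \<rho>: "sets \<rho> = sets \<mu>" for \<rho>
  proof -
    interpret prob_space \<rho> by fact
    have "integrable \<rho> g"
      using g M sets_eq_imp_space_eq[OF \<rho>] \<rho>
      by (intro integrable_const_bound[where B=M]) (auto cong: measurable_cong_sets)
    then show ?thesis by (simp add: prob_space)
  qed
  have "2 * \<bar>(\<integral>y. (g y + M) / (2 * M) \<partial>\<mu>) - (\<integral>y. (g y + M) / (2 * M) \<partial>\<nu>)\<bar> \<le> tv_dist \<mu> \<nu>"
  proof (rule abs_integral_diff_le_tv_dist_unit[OF assms(1-3)])
    show "(\<lambda>y. (g y + M) / (2 * M)) \<in> borel_measurable \<mu>" using g by measurable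
    show "0 \<le> (g y + M) / (2 * M) \<and> (g y + M) / (2 * M) \<le> 1" if "y \<in> space \<mu>" for y
      using M(1) M(2)[OF that] by (auto simp: field_simps abs_le_iff)
  qed
  moreover have "((\<integral>y. g y \<partial>\<mu>) + M) / (2 * M) - ((\<integral>y. g y \<partial>\<nu>) + M) / (2 * M)
      = ((\<integral>y. g y \<partial>\<mu>) - (\<integral>y. g y \<partial>\<nu>)) / (2 * M)"
    by (simp add: diff_divide_distrib[symmetric])
  ultimately show ?thesis
    using M(1) I[OF assms(1) refl] I[OF assms(2) sets_eq[symmetric]]
    by (simp add: abs_mult abs_divide field_simps)
qed

section \<open>Weak convergence, uniformly over equicontinuous families\<close>

text \<open>Where a bump is nonzero, replacing \<open>f\<close> by the constant \<open>v i\<close>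
  costs at most \<open>e\<close>. What the bumps leave uncovered costs at most \<open>M\<close>
  times the missing mass.\<close>

lemma abs_integral_diff_subpartition_le:
  fixes f :: "'a \<Rightarrow> real" and \<phi> :: "nat \<Rightarrow> 'a \<Rightarrow> real"
  assumes "prob_space R"
    and f: "f \<in> borel_measurable R" "\<And>x. x \<in> space R \<Longrightarrow> \<bar>f x\<bar> \<le> M"
    and \<phi>: "\<And>i. \<phi> i \<in> borel_measurable R" "\<And>i x. x \<in> space R \<Longrightarrow> 0 \<le> \<phi> i x"
      "\<And>x. x \<in> space R \<Longrightarrow> (\<Sum>i<N. \<phi> i x) \<le> 1"
    and near: "\<And>i x. x \<in> space R \<Longrightarrow> \<phi> i x \<noteq> 0 \<Longrightarrow> \<bar>f x - v i\<bar> \<le> e"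
    and "0 \<le> e"
  shows "\<bar>(\<integral>x. f x \<partial>R) - (\<Sum>i<N. v i * (\<integral>x. \<phi> i x \<partial>R))\<bar>
    \<le> e + M * (1 - (\<Sum>i<N. \<integral>x. \<phi> i x \<partial>R))"
proof -
  interpret prob_space R by fact
  have i_f: "integrable R f"
    using f by (intro integrable_const_bound[where B=M]) auto
  have "\<phi> i x \<le> 1" if "i < N" "x \<in> space R" for i x
    using member_le_sum[of i "{..<N}" "\<lambda>i. \<phi> i x"] \<phi>(2,3)[OF that(2)] that(1)
    by (auto intro: order_trans)
  then have i_\<phi>: "integrable R (\<phi> i)" if "i < N" for i
    using \<phi>(1,2) that by (intro integrable_const_bound[where B=1]) auto
  let ?h = "\<lambda>x. f x - (\<Sum>i<N. v i * \<phi> i x)"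
  let ?b = "\<lambda>x. e + M * (1 - (\<Sum>i<N. \<phi> i x))"
  have bound: "\<bar>?h x\<bar> \<le> ?b x" if x: "x \<in> space R" for x
  proof -
    \<comment> \<open>The first term is the oscillation on the bumps, the second the uncovered
      part.\<close>
    have "?h x = (\<Sum>i<N. (f x - v i) * \<phi> i x) + f x * (1 - (\<Sum>i<N. \<phi> i x))"
      by (simp add: left_diff_distrib sum_subtractf sum_distrib_left right_diff_distrib)
    also have "\<bar>\<dots>\<bar> \<le> (\<Sum>i<N. \<bar>(f x - v i) * \<phi> i x\<bar>) + \<bar>f x * (1 - (\<Sum>i<N. \<phi> i x))\<bar>"
      by (rule order_trans[OF abs_triangle_ineq]) (intro add_mono sum_abs order_refl)
    also have "\<dots> \<le> (\<Sum>i<N. e * \<phi> i x) + M * (1 - (\<Sum>i<N. \<phi> i x))"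
    proof (intro add_mono sum_mono)
      \<comment> \<open>Where \<open>\<phi> i x\<close> vanishes, \<open>near\<close> says nothing,
        but both sides are zero.\<close>
      show "\<bar>(f x - v i) * \<phi> i x\<bar> \<le> e * \<phi> i x" for i
        using near[OF x, of i] \<phi>(2)[OF x, of i]
        by (cases "\<phi> i x = 0") (auto simp: abs_mult intro!: mult_right_mono)
      show "\<bar>f x * (1 - (\<Sum>i<N. \<phi> i x))\<bar> \<le> M * (1 - (\<Sum>i<N. \<phi> i x))"
        using f(2)[OF x] \<phi>(3)[OF x] by (simp add: abs_mult mult_right_mono)
    qed
    also have "(\<Sum>i<N. e * \<phi> i x) = e * (\<Sum>i<N. \<phi> i x)"
      by (simp add: sum_distrib_left)
    also have "e * (\<Sum>i<N. \<phi> i x) \<le> e"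
      using \<phi>(3)[OF x] \<open>0 \<le> e\<close> by (rule mult_left_le)
    finally show ?thesis by simp
  qed
  have i_v\<phi>: "integrable R (\<lambda>x. v i * \<phi> i x)" if "i \<in> {..<N}" for i v
    using i_\<phi> that by (intro integrable_mult_right) auto
  have i_sum: "integrable R (\<lambda>x. \<Sum>i<N. \<phi> i x)" "integrable R (\<lambda>x. \<Sum>i<N. v i * \<phi> i x)"
    using i_\<phi> i_v\<phi> by (auto intro!: Bochner_Integration.integrable_sum)
  have sums: "(\<integral>x. (\<Sum>i<N. \<phi> i x) \<partial>R) = (\<Sum>i<N. \<integral>x. \<phi> i x \<partial>R)"
    "(\<integral>x. (\<Sum>i<N. v i * \<phi> i x) \<partial>R) = (\<Sum>i<N. v i * (\<integral>x. \<phi> i x \<partial>R))"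
    using i_\<phi> by (auto simp: Bochner_Integration.integral_sum[OF i_v\<phi>]
        intro!: Bochner_Integration.integral_sum)
  have "\<bar>\<integral>x. ?h x \<partial>R\<bar> \<le> (\<integral>x. ?b x \<partial>R)"
    using bound i_f i_sum by (intro order_trans[OF integral_abs_bound] integral_mono) auto
  moreover have "(\<integral>x. ?h x \<partial>R) = (\<integral>x. f x \<partial>R) - (\<Sum>i<N. v i * (\<integral>x. \<phi> i x \<partial>R))"
    using i_f i_sum sums by simp
  moreover have "(\<integral>x. ?b x \<partial>R) = e + M * (1 - (\<Sum>i<N. \<integral>x. \<phi> i x \<partial>R))"
    using i_sum sums by (simp add: prob_space)
  ultimately show ?thesis by simp
qed

lemma borel_measurable_continuous_on_prob_measures:
  fixes f :: "'a::topological_space \<Rightarrow> real"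
  assumes "P \<in> prob_measures X" "continuous_on X f"
  shows "f \<in> borel_measurable P"
  using assms borel_measurable_continuous_on_restrict[OF assms(2)]
  by (auto simp: prob_measures_def cong: measurable_cong_sets)

lemma space_prob_measures: "P \<in> prob_measures X \<Longrightarrow> space P = X"
  by (auto simp: prob_measures_def space_restrict_space dest: sets_eq_imp_space_eq)

text \<open>Countably many of the balls cover \<open>X\<close> by the Lindelof property. Suitably
  normalised bumps on the first \<open>N\<close> of them have sums tending to 1 pointwise on
  \<open>X\<close>, so by dominated convergence finitely many bumps carry almost all the mass of
  \<open>P\<close>. No compactness of \<open>X\<close> or tightness is involved.\<close>

lemma exists_subpartition_subordinate:
  fixes X :: "'a::{metric_space, second_countable_topology} set"
  assumes P: "P \<in> prob_measures X" and r: "\<And>x. x \<in> X \<Longrightarrow> 0 < r x" and "0 < e"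
  obtains a :: "nat \<Rightarrow> 'a" and \<phi> :: "nat \<Rightarrow> 'a \<Rightarrow> real" and N :: nat
  where "\<And>i. a i \<in> X" "\<And>i. continuous_on UNIV (\<phi> i)" "\<And>i x. 0 \<le> \<phi> i x"
    "\<And>x. (\<Sum>i<N. \<phi> i x) \<le> 1" "\<And>i x. \<phi> i x \<noteq> 0 \<Longrightarrow> dist (a i) x < r (a i)"
    "1 - e < (\<Sum>i<N. \<integral>x. \<phi> i x \<partial>P)"
proof -
  interpret prob_space P using P by (simp add: prob_measures_def)
  note sp = space_prob_measures[OF P]
  obtain \<C> where "\<C> \<subseteq> (\<lambda>x. ball x (r x)) ` X" "countable \<C>"
    "\<Union>\<C> = \<Union>((\<lambda>x. ball x (r x)) ` X)"
    by (rule Lindelof[of "(\<lambda>x. ball x (r x)) ` X"]) auto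
  then obtain A where A: "A \<subseteq> X" "countable A" "X \<subseteq> (\<Union>x\<in>A. ball x (r x))"
  proof -
    from \<open>\<C> \<subseteq> _\<close> \<open>countable \<C>\<close> obtain A where A: "countable A" "A \<subseteq> X"
      "\<C> = (\<lambda>x. ball x (r x)) ` A"
      using countable_subset_image[of \<C> "\<lambda>x. ball x (r x)" X] by blast
    have "X \<subseteq> \<Union>\<C>"
      unfolding \<open>\<Union>\<C> = _\<close> using r by (auto intro: centre_in_ball[THEN iffD2])
    then show ?thesis using that A by simp
  qed
  \<comment> \<open>The space of a probability measure is nonempty, so \<open>from_nat_into\<close>
    enumerates \<open>A\<close>, possibly with harmless repetitions.\<close>
  have "A \<noteq> {}" using A(3) not_empty sp by auto
  define a where "a = from_nat_into A"
  have aX: "a i \<in> X" for i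
    using from_nat_into[OF \<open>A \<noteq> {}\<close>] A(1) by (auto simp: a_def)
  have cover: "\<exists>i. dist (a i) x < r (a i)" if x: "x \<in> X" for x
  proof -
    obtain z where "z \<in> A" "dist z x < r z" using x A(3) by auto
    moreover from from_nat_into_surj[OF A(2) \<open>z \<in> A\<close>] obtain i where "a i = z"
      by (auto simp: a_def)
    ultimately show ?thesis by blast
  qed
  \<comment> \<open>Continuous, and positive exactly on the open ball around
    \<open>a i\<close>.\<close>
  define \<psi> where "\<psi> i x = max 0 (r (a i) - dist (a i) x)" for i x
  define S where "S N x = (\<Sum>j<N. \<psi> j x)" for N :: nat and x
  \<comment> \<open>The summand 1 keeps the denominator positive even outside the cover, so
    \<open>\<phi> N i\<close> is continuous everywhere. The factor \<open>N\<close> drives the sum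
    to 1 wherever some bump is positive. The same \<open>N\<close> later serves as scale and as
    number of bumps.\<close>
  define \<phi> where "\<phi> N i x = real N * \<psi> i x / (1 + real N * S N x)" for N i x
  have \<psi>0: "0 \<le> \<psi> i x" for i x by (simp add: \<psi>_def)
  have S0: "0 \<le> S N x" for N x by (simp add: S_def sum_nonneg \<psi>0)
  have den: "0 < 1 + real N * S N x" for N x
    using S0[of N x] by (intro add_pos_nonneg) auto
  have \<phi>0: "0 \<le> \<phi> N i x" for N i x
    using den[of N x] \<psi>0[of i x] by (simp add: \<phi>_def)
  have sum\<phi>: "(\<Sum>i<N. \<phi> N i x) = real N * S N x / (1 + real N * S N x)" for N x
    by (simp add: \<phi>_def S_def sum_divide_distrib sum_distrib_left)
  have le1: "(\<Sum>i<N. \<phi> N i x) \<le> 1" for N x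
    unfolding sum\<phi> using den[of N x] by (simp add: divide_le_eq)
  have cont\<psi>: "continuous_on UNIV (\<psi> i)" for i
    unfolding \<psi>_def by (intro continuous_intros)
  have cont: "continuous_on UNIV (\<phi> N i)" for N i
    unfolding \<phi>_def S_def
    by (intro continuous_intros cont\<psi>) (use den[of N] in \<open>auto simp: S_def less_le\<close>)
  have meas: "\<phi> N i \<in> borel_measurable P" for N i
    by (rule borel_measurable_continuous_on_prob_measures[OF P continuous_on_subset[OF cont]]) simp
  have lim: "(\<lambda>N. \<Sum>i<N. \<phi> N i x) \<longlonglongrightarrow> 1" if "x \<in> X" for x
  proof -
    obtain k where "dist (a k) x < r (a k)" using cover[OF \<open>x \<in> X\<close>] by blast
    then have k: "0 < \<psi> k x" by (simp add: \<psi>_def)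
    have "(\<lambda>N. 1 - 1 / (1 + real N * \<psi> k x)) \<longlonglongrightarrow> 1 - 0"
      using k by real_asymp
    \<comment> \<open>As soon as \<open>N\<close> exceeds \<open>k\<close>, the bump
      \<open>\<psi> k\<close> is part of \<open>S N\<close>, and the normalised sum is increasing in
      \<open>S N x\<close>.\<close>
    moreover have "\<forall>\<^sub>F N in sequentially. 1 - 1 / (1 + real N * \<psi> k x) \<le> (\<Sum>i<N. \<phi> N i x)"
      using eventually_gt_at_top[of k]
    proof eventually_elim
      case (elim N)
      have "\<psi> k x \<le> S N x"
        unfolding S_def using elim \<psi>0 by (intro member_le_sum) auto
      then have "1 / (1 + real N * S N x) \<le> 1 / (1 + real N * \<psi> k x)"
        using k by (intro divide_left_mono add_left_mono mult_left_mono mult_pos_pos)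
          (auto intro!: add_pos_nonneg den)
      moreover have "(\<Sum>i<N. \<phi> N i x) = 1 - 1 / (1 + real N * S N x)"
        unfolding sum\<phi> using den[of N x] by (simp add: field_simps)
      ultimately show ?case by linarith
    qed
    moreover have "\<forall>\<^sub>F N in sequentially. (\<Sum>i<N. \<phi> N i x) \<le> 1"
      by (rule always_eventually) (use le1 in blast)
    ultimately show ?thesis
      using tendsto_sandwich[where h="\<lambda>_. 1" and c="1::real"] by auto
  qed
  have "(\<lambda>N. \<integral>x. (\<Sum>i<N. \<phi> N i x) \<partial>P) \<longlonglongrightarrow> (\<integral>x. 1 \<partial>P)"
  proof (rule integral_dominated_convergence[where w="\<lambda>_. 1" and f="\<lambda>_. 1"
        and s="\<lambda>N x. \<Sum>i<N. \<phi> N i x"])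
    show "AE x in P. norm (\<Sum>i<N. \<phi> N i x) \<le> 1" for N
      using le1 \<phi>0 by (intro AE_I2) (simp add: sum_nonneg)
    show "AE x in P. (\<lambda>N. \<Sum>i<N. \<phi> N i x) \<longlonglongrightarrow> 1"
      using lim sp by (intro AE_I2) simp
    show "(\<lambda>x. \<Sum>i<N. \<phi> N i x) \<in> borel_measurable P" for N
      by (intro borel_measurable_sum meas)
  qed simp_all
  moreover have "integrable P (\<phi> N i)" if "i < N" for N i
  proof (rule integrable_const_bound[where B=1])
    have "\<phi> N i x \<le> 1" for x
      using member_le_sum[of i "{..<N}" "\<lambda>i. \<phi> N i x"] \<phi>0 le1[of N x] that
      by (auto intro: order_trans)
    then show "AE x in P. norm (\<phi> N i x) \<le> 1" using \<phi>0 by auto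
  qed (rule meas)
  ultimately have "(\<lambda>N. \<Sum>i<N. \<integral>x. \<phi> N i x \<partial>P) \<longlonglongrightarrow> 1"
    by (simp add: prob_space)
  then have "\<forall>\<^sub>F N in sequentially. 1 - e < (\<Sum>i<N. \<integral>x. \<phi> N i x \<partial>P)"
    using \<open>0 < e\<close> by (intro order_tendstoD) auto
  then obtain N where "1 - e < (\<Sum>i<N. \<integral>x. \<phi> N i x \<partial>P)"
    by (meson eventually_happens' sequentially_bot)
  moreover have "dist (a i) x < r (a i)" if "\<phi> N i x \<noteq> 0" for i x
    using that by (auto simp: \<phi>_def \<psi>_def max_def split: if_splits)
  ultimately show ?thesis
    using that[of a "\<phi> N" N] aX cont \<phi>0 le1 by blast
qed

text \<open>Supplies measurability of the members of the family, which their integrals need.\<close>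

lemma continuous_on_equicontinuous:
  fixes F :: "('a::metric_space \<Rightarrow> real) set"
  assumes equicont: "\<And>x e. x \<in> X \<Longrightarrow> 0 < e \<Longrightarrow>
      \<exists>r>0. \<forall>f\<in>F. \<forall>y\<in>X. dist x y < r \<longrightarrow> \<bar>f y - f x\<bar> \<le> e"
    and f: "f \<in> F"
  shows "continuous_on X f"
  unfolding continuous_on_iff
proof (intro ballI allI impI)
  fix x and e :: real assume x: "x \<in> X" and "0 < e"
  then obtain r where "0 < r" "\<forall>f\<in>F. \<forall>y\<in>X. dist x y < r \<longrightarrow> \<bar>f y - f x\<bar> \<le> e / 2"
    using equicont[OF x, of "e / 2"] by auto
  with f show "\<exists>r>0. \<forall>y\<in>X. dist y x < r \<longrightarrow> dist (f y) (f x) < e"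
  proof (intro exI[of _ r] conjI ballI impI)
    fix y assume "y \<in> X" "dist y x < r"
    with f \<open>\<forall>f\<in>F. _ f\<close> have "\<bar>f y - f x\<bar> \<le> e / 2" by (simp add: dist_commute)
    then show "dist (f y) (f x) < e" using \<open>0 < e\<close> by (simp add: dist_real_def)
  qed
qed

text \<open>One subpartition, chosen from \<open>F\<close> and \<open>P\<close> alone, reduces the
  integrals of all members of \<open>F\<close> to integrals of finitely many bumps. Weak convergence
  is applied only to these bumps, so its rate does not depend on \<open>f\<close>.\<close>

lemma weakly_converges_uniform_on_equicontinuous:
  fixes X :: "'a::{metric_space, second_countable_topology} set" and F :: "('a \<Rightarrow> real) set"
  assumes Ps: "\<And>n. Ps n \<in> prob_measures X" and P: "P \<in> prob_measures X"
    and weak: "weakly_converges X Ps P"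
    and bound: "\<And>f x. f \<in> F \<Longrightarrow> x \<in> X \<Longrightarrow> \<bar>f x\<bar> \<le> M"
    and equicont: "\<And>x e. x \<in> X \<Longrightarrow> 0 < e \<Longrightarrow>
      \<exists>r>0. \<forall>f\<in>F. \<forall>y\<in>X. dist x y < r \<longrightarrow> \<bar>f y - f x\<bar> \<le> e"
    and "0 < e"
  shows "\<forall>\<^sub>F n in sequentially. \<forall>f\<in>F. \<bar>(\<integral>x. f x \<partial>Ps n) - (\<integral>x. f x \<partial>P)\<bar> \<le> e"
proof -
  \<comment> \<open>\<open>M\<close> may be zero, or negative if \<open>F\<close> is empty;
    \<open>K\<close> is a positive bound that can be divided by.\<close>
  define K where "K = \<bar>M\<bar> + 1"
  \<comment> \<open>Two oscillation errors of \<open>d\<close> and two mass defects below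
    \<open>d\<close> make up the limiting error; a fifth share keeps it strictly below
    \<open>e\<close>.\<close>
  define d where "d = e / 5"
  have K: "0 < K" and d: "0 < d" using \<open>0 < e\<close> by (auto simp: K_def d_def)
  have boundK: "\<bar>f x\<bar> \<le> K" if "f \<in> F" "x \<in> X" for f x
    using bound[OF that] by (simp add: K_def)
  have "\<forall>x\<in>X. \<exists>r>0. \<forall>f\<in>F. \<forall>y\<in>X. dist x y < r \<longrightarrow> \<bar>f y - f x\<bar> \<le> d"
    using equicont d by blast
  then obtain r where r: "\<And>x. x \<in> X \<Longrightarrow> 0 < r x"
    "\<And>x f y. \<lbrakk>x \<in> X; f \<in> F; y \<in> X; dist x y < r x\<rbrakk> \<Longrightarrow> \<bar>f y - f x\<bar> \<le> d"
    unfolding bchoice_iff by blast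
  have contF: "continuous_on X f" if f: "f \<in> F" for f
    by (rule continuous_on_equicontinuous[OF equicont f])
  obtain a \<phi> and N :: nat where aX: "\<And>i. a i \<in> X" and cont: "\<And>i. continuous_on UNIV (\<phi> i)"
    and \<phi>0: "\<And>i x. 0 \<le> \<phi> i x" and le1: "\<And>x. (\<Sum>i<N. \<phi> i x) \<le> 1"
    and supp: "\<And>i x. \<phi> i x \<noteq> 0 \<Longrightarrow> dist (a i) x < r (a i)"
    and mass: "1 - d / K < (\<Sum>i<N. \<integral>x. \<phi> i x \<partial>P)"
    using exists_subpartition_subordinate[where r=r and e="d / K", OF P _ divide_pos_pos[OF d K]] r(1)
    by metis
  \<comment> \<open>With the mass defect kept as a term of the bound, the estimate covers each
    \<open>Ps n\<close> as well as \<open>P\<close>.\<close>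
  have approx: "\<bar>(\<integral>x. f x \<partial>R) - (\<Sum>i<N. f (a i) * (\<integral>x. \<phi> i x \<partial>R))\<bar>
      \<le> d + K * (1 - (\<Sum>i<N. \<integral>x. \<phi> i x \<partial>R))"
    if R: "R \<in> prob_measures X" and f: "f \<in> F" for R f
  proof (rule abs_integral_diff_subpartition_le)
    show "prob_space R" using R by (simp add: prob_measures_def)
    show "f \<in> borel_measurable R"
      by (rule borel_measurable_continuous_on_prob_measures[OF R contF[OF f]])
    show "\<phi> i \<in> borel_measurable R" for i
      by (rule borel_measurable_continuous_on_prob_measures[OF R continuous_on_subset[OF cont]]) simp
    show "\<bar>f x - f (a i)\<bar> \<le> d" if "x \<in> space R" "\<phi> i x \<noteq> 0" for i x
      using r(2)[OF aX f _ supp[OF that(2)]] that(1) space_prob_measures[OF R] by simp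
  qed (use boundK f \<phi>0 le1 d space_prob_measures[OF R] in auto)
  have lim\<phi>: "(\<lambda>n. \<integral>x. \<phi> i x \<partial>Ps n) \<longlonglongrightarrow> (\<integral>x. \<phi> i x \<partial>P)" if "i < N" for i
  proof -
    have "\<phi> i x \<le> 1" for x
      using member_le_sum[of i "{..<N}" "\<lambda>i. \<phi> i x"] \<phi>0 le1[of x] that
      by (auto intro: order_trans)
    then have "bounded (\<phi> i ` X)"
      using \<phi>0 by (auto simp: bounded_iff intro!: exI[of _ 1])
    then show ?thesis
      using weak continuous_on_subset[OF cont[of i], of X] by (simp add: weakly_converges_def)
  qed
  \<comment> \<open>The total error bound. It does not mention \<open>f\<close>, and as a finite
    expression in the bump integrals it converges.\<close>
  define B where "B n = 2 * d + K * (1 - (\<Sum>i<N. \<integral>x. \<phi> i x \<partial>Ps n))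
    + K * (1 - (\<Sum>i<N. \<integral>x. \<phi> i x \<partial>P))
    + (\<Sum>i<N. K * \<bar>(\<integral>x. \<phi> i x \<partial>Ps n) - (\<integral>x. \<phi> i x \<partial>P)\<bar>)" for n
  define q where "q = K * (1 - (\<Sum>i<N. \<integral>x. \<phi> i x \<partial>P))"
  have "B \<longlonglongrightarrow> 2 * d + q + q + (\<Sum>i<N. K * \<bar>(\<integral>x. \<phi> i x \<partial>P) - (\<integral>x. \<phi> i x \<partial>P)\<bar>)"
    unfolding B_def q_def by (intro tendsto_intros lim\<phi>) auto
  then have "B \<longlonglongrightarrow> 2 * d + q + q"
    by simp
  moreover have "q < d"
    using mass K by (simp add: q_def field_simps)
  then have "2 * d + q + q < e"
    using \<open>0 < e\<close> by (simp add: d_def)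
  ultimately have "\<forall>\<^sub>F n in sequentially. B n < e"
    by (rule order_tendstoD)
  then show ?thesis
  proof (eventually_elim, intro ballI)
    fix n f assume "B n < e" and f: "f \<in> F"
    have "\<bar>(\<Sum>i<N. f (a i) * (\<integral>x. \<phi> i x \<partial>Ps n)) - (\<Sum>i<N. f (a i) * (\<integral>x. \<phi> i x \<partial>P))\<bar>
        \<le> (\<Sum>i<N. \<bar>f (a i) * (\<integral>x. \<phi> i x \<partial>Ps n) - f (a i) * (\<integral>x. \<phi> i x \<partial>P)\<bar>)"
      by (simp only: sum_subtractf[symmetric] sum_abs)
    also have "\<dots> \<le> (\<Sum>i<N. K * \<bar>(\<integral>x. \<phi> i x \<partial>Ps n) - (\<integral>x. \<phi> i x \<partial>P)\<bar>)"
      by (intro sum_mono)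
        (simp add: right_diff_distrib[symmetric] abs_mult mult_right_mono boundK[OF f aX])
    finally show "\<bar>(\<integral>x. f x \<partial>Ps n) - (\<integral>x. f x \<partial>P)\<bar> \<le> e"
      using approx[OF Ps f, of n] approx[OF P f] \<open>B n < e\<close> unfolding B_def by linarith
  qed
qed

section \<open>Channels, policies and equicontinuity of the expected cost\<close>

lemma channelsD:
  assumes "Q \<in> channels X Y" "x \<in> X"
  shows "prob_space (Q x)" "sets (Q x) = sets (borel_on Y)"
  using assms
  by (auto simp: channels_def space_restrict_space space_prob_algebra dest!: measurable_space[where x=x])

text \<open>\<open>X\<close> is metric, so the sequential condition is continuity of
  \<open>tv_dist (Q y) (Q x)\<close> in \<open>y\<close> at \<open>x\<close>, where its value is 0
  by \<open>tv_dist_self\<close>. The absolute value is the distance to that value.\<close>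

lemma tv_continuousD:
  fixes X :: "'a::metric_space set"
  assumes "tv_continuous X Q" "x \<in> X" "0 < e"
  shows "\<exists>r>0. \<forall>y\<in>X. dist x y < r \<longrightarrow> \<bar>tv_dist (Q y) (Q x)\<bar> < e"
proof -
  have "continuous (at x within X) (\<lambda>y. tv_dist (Q y) (Q x))"
    using assms(1,2) unfolding continuous_within_sequentially tv_continuous_def
    by (auto simp: o_def tv_dist_self)
  with \<open>0 < e\<close> show ?thesis
    unfolding continuous_within_eps_delta
    by (auto simp: dist_real_def tv_dist_self dist_commute)
qed

text \<open>The section \<open>c x\<close> is continuous on \<open>U\<close>, hence Borel there, and
  is composed with \<open>\<gamma>\<close>. The point and the measure are decoupled because the cost
  at \<open>x\<close> is also integrated against \<open>Q z\<close>.\<close>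

lemma measurable_cost_section:
  assumes c: "continuous_on (X \<times> U) (\<lambda>(x, u). c x u)" and "x \<in> X"
    and "\<gamma> \<in> policies Y U" and "sets \<mu> = sets (borel_on Y)"
  shows "(\<lambda>y. c x (\<gamma> y)) \<in> borel_measurable \<mu>"
proof -
  have "continuous_on U (\<lambda>u. c x u)"
    using continuous_on_compose2[OF c continuous_on_Pair[OF continuous_on_const continuous_on_id]]
      \<open>x \<in> X\<close>
    by (simp add: subset_eq)
  then have "c x \<in> borel_measurable (borel_on U)"
    by (rule borel_measurable_continuous_on_restrict)
  moreover have "\<gamma> \<in> \<mu> \<rightarrow>\<^sub>M borel_on U"
    using assms(3,4) by (auto simp: policies_def cong: measurable_cong_sets)
  ultimately show ?thesis by measurable
qed

lemma policies_range:
  assumes "\<gamma> \<in> policies Y U" "y \<in> Y" shows "\<gamma> y \<in> U"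
  using measurable_space[of \<gamma> "borel_on Y" "borel_on U" y] assms
  by (auto simp: policies_def space_restrict_space)

text \<open>Passing through the integral of the cost at \<open>x\<close> against \<open>Q z\<close>
  separates the change of integrand from the change of measure. Both radii are fixed before the
  policy, which gives uniformity.\<close>

lemma expected_cost_equicontinuous:
  fixes X :: "'a::metric_space set" and U :: "'u::metric_space set"
    and c :: "'a \<Rightarrow> 'u \<Rightarrow> real"
  assumes c: "continuous_on (X \<times> U) (\<lambda>(x, u). c x u)" and "compact U"
    and M: "0 < M" "\<And>x u. x \<in> X \<Longrightarrow> u \<in> U \<Longrightarrow> \<bar>c x u\<bar> \<le> M"
    and Q: "Q \<in> channels X Y" "tv_continuous X Q" and x: "x \<in> X" and "0 < e"
  shows "\<exists>r>0. \<forall>\<gamma>\<in>policies Y U. \<forall>z\<in>X. dist x z < r \<longrightarrow>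
    \<bar>(\<integral>y. c z (\<gamma> y) \<partial>Q z) - (\<integral>y. c x (\<gamma> y) \<partial>Q x)\<bar> \<le> e"
proof -
  \<comment> \<open>Compactness of \<open>U\<close> makes one neighbourhood serve all
    actions.\<close>
  obtain V where V: "x \<in> V" "open V"
    "\<forall>z\<in>V \<inter> X. \<forall>u\<in>U. dist (c z u) (c x u) \<le> e / 2"
    using continuous_on_prod_compactE[OF c \<open>compact U\<close> x, of "e / 2"] \<open>0 < e\<close> by auto
  obtain r1 where r1: "0 < r1" "ball x r1 \<subseteq> V"
    using V(1,2) open_contains_ball by blast
  \<comment> \<open>The tolerance becomes \<open>e / 2\<close> once multiplied by the bound
    \<open>M\<close> on the cost.\<close>
  obtain r2 where r2: "0 < r2" "\<forall>z\<in>X. dist x z < r2 \<longrightarrow> \<bar>tv_dist (Q z) (Q x)\<bar> < e / (2 * M)"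
    using tv_continuousD[OF Q(2) x, of "e / (2 * M)"] \<open>0 < e\<close> M(1) by auto
  have "\<bar>(\<integral>y. c z (\<gamma> y) \<partial>Q z) - (\<integral>y. c x (\<gamma> y) \<partial>Q x)\<bar> \<le> e"
    if \<gamma>: "\<gamma> \<in> policies Y U" and z: "z \<in> X" "dist x z < min r1 r2" for \<gamma> z
  proof -
    note Qz = channelsD[OF Q(1) z(1)] and Qx = channelsD[OF Q(1) x]
    interpret Qz: prob_space "Q z" by (rule Qz(1))
    have space: "space (Q z) = Y"
      using sets_eq_imp_space_eq[OF Qz(2)] by (simp add: space_restrict_space)
    have meas: "(\<lambda>y. c w (\<gamma> y)) \<in> borel_measurable (Q z)" if "w \<in> X" for w
      by (rule measurable_cost_section[OF c that \<gamma> Qz(2)])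
    have bd: "\<bar>c w (\<gamma> y)\<bar> \<le> M" if "w \<in> X" "y \<in> Y" for w y
      using M(2) that policies_range[OF \<gamma>] by blast
    have int: "integrable (Q z) (\<lambda>y. c w (\<gamma> y))" if "w \<in> X" for w
      using meas[OF that] bd[OF that] space
      by (intro Qz.integrable_const_bound[where B=M]) auto
    have "\<bar>(\<integral>y. c z (\<gamma> y) \<partial>Q z) - (\<integral>y. c x (\<gamma> y) \<partial>Q z)\<bar> = \<bar>\<integral>y. c z (\<gamma> y) - c x (\<gamma> y) \<partial>Q z\<bar>"
      using int[OF z(1)] int[OF x] by simp
    also have "\<dots> \<le> (\<integral>y. \<bar>c z (\<gamma> y) - c x (\<gamma> y)\<bar> \<partial>Q z)"
      by (rule integral_abs_bound)
    also have "\<dots> \<le> e / 2"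
    proof (rule Qz.integral_le_const)
      show "integrable (Q z) (\<lambda>y. \<bar>c z (\<gamma> y) - c x (\<gamma> y)\<bar>)"
        using int[OF z(1)] int[OF x] by simp
      have "z \<in> V" using z(2) r1(2) by auto
      then show "AE y in Q z. \<bar>c z (\<gamma> y) - c x (\<gamma> y)\<bar> \<le> e / 2"
        using V(3) z(1) policies_range[OF \<gamma>] space by (auto simp: dist_real_def)
    qed
    finally have 1: "\<bar>(\<integral>y. c z (\<gamma> y) \<partial>Q z) - (\<integral>y. c x (\<gamma> y) \<partial>Q z)\<bar> \<le> e / 2" .
    have "\<bar>(\<integral>y. c x (\<gamma> y) \<partial>Q z) - (\<integral>y. c x (\<gamma> y) \<partial>Q x)\<bar> \<le> M * tv_dist (Q z) (Q x)"
      using Qz Qx meas[OF x] M(1) bd[OF x] space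
      by (intro abs_integral_diff_le_tv_dist) auto
    also have "\<dots> \<le> M * (e / (2 * M))"
      using r2(2) z M(1) by (intro mult_left_mono) (auto simp: abs_less_iff less_imp_le)
    also have "\<dots> = e / 2" using M(1) by simp
    finally show ?thesis using 1 by linarith
  qed
  then show ?thesis using r1(1) r2(1) by (intro exI[of _ "min r1 r2"]) auto
qed

section \<open>Convergence of the optimal costs\<close>

theorem theorem2p5:
  fixes X :: "'a::euclidean_space set"
    and Y :: "'b::euclidean_space set"
    and U :: "'u::euclidean_space set"
    and c :: "'a \<Rightarrow> 'u \<Rightarrow> real"
    and Q :: "'a \<Rightarrow> 'b measure"
    and P :: "'a measure"
    and Ps :: "nat \<Rightarrow> 'a measure"
  assumes "X \<in> sets borel" and "Y \<in> sets borel" and "U \<in> sets borel"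
    and "continuous_on (X \<times> U) (\<lambda>(x, u). c x u)"
    and "bounded ((\<lambda>(x, u). c x u) ` (X \<times> U))"
    and "compact U"
    and "Q \<in> channels X Y"
    and "tv_continuous X Q"
    and "\<And>n. Ps n \<in> prob_measures X"
    and "P \<in> prob_measures X"
    and "weakly_converges X Ps P"
  shows "(\<lambda>n. opt_cost Y U c (Ps n) Q) \<longlonglongrightarrow> opt_cost Y U c P Q"
proof (cases "policies Y U = {}")
  \<comment> \<open>Without policies every optimal cost is the same \<open>Inf {}\<close>, so the
    sequence is constant.\<close>
  case True
  then show ?thesis by (simp add: opt_cost_def)
next
  case False
  note c = assms(4) and Q = assms(7,8) and Ps = assms(9) and P = assms(10)
  obtain M where M: "0 < M" "\<And>x u. x \<in> X \<Longrightarrow> u \<in> U \<Longrightarrow> \<bar>c x u\<bar> \<le> M"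
    using assms(5) unfolding bounded_pos by auto
  define F where "F \<gamma> x = (\<integral>y. c x (\<gamma> y) \<partial>Q x)" for \<gamma> x
  have F_bound: "\<bar>F \<gamma> x\<bar> \<le> M" if \<gamma>: "\<gamma> \<in> policies Y U" and x: "x \<in> X" for \<gamma> x
  proof -
    note Qx = channelsD[OF Q(1) x]
    interpret prob_space "Q x" by (rule Qx(1))
    have space: "space (Q x) = Y"
      using sets_eq_imp_space_eq[OF Qx(2)] by (simp add: space_restrict_space)
    have "AE y in Q x. \<bar>c x (\<gamma> y)\<bar> \<le> M"
      using M(2)[OF x] policies_range[OF \<gamma>] space by auto
    moreover from this have "integrable (Q x) (\<lambda>y. c x (\<gamma> y))"
      using measurable_cost_section[OF c x \<gamma> Qx(2)]
      by (intro integrable_const_bound[where B=M]) auto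
    ultimately show ?thesis
      unfolding F_def
      by (intro order_trans[OF integral_abs_bound] integral_le_const) auto
  qed
  have equicont: "\<exists>r>0. \<forall>f\<in>F ` policies Y U. \<forall>z\<in>X. dist x z < r \<longrightarrow> \<bar>f z - f x\<bar> \<le> e"
    if "x \<in> X" "0 < e" for x e
    using expected_cost_equicontinuous[OF c assms(6) M Q that] by (auto simp: F_def)
  have cost_eq: "cost c R Q \<gamma> = (\<integral>x. F \<gamma> x \<partial>R)" for R \<gamma>
    by (simp add: cost_def F_def)
  have contF: "continuous_on X (F \<gamma>)" if "\<gamma> \<in> policies Y U" for \<gamma>
    by (rule continuous_on_equicontinuous[OF equicont]) (use that in auto)
  \<comment> \<open>Needed for the real infima to be compared by
    \<open>abs_diff_cINF_le\<close>.\<close>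
  have cost_bdd: "bdd_below (cost c R Q ` policies Y U)" if R: "R \<in> prob_measures X" for R
  proof (rule bdd_belowI2)
    fix \<gamma> assume \<gamma>: "\<gamma> \<in> policies Y U"
    interpret prob_space R using R by (simp add: prob_measures_def)
    have ae: "AE x in R. \<bar>F \<gamma> x\<bar> \<le> M"
      using F_bound[OF \<gamma>] space_prob_measures[OF R] by auto
    moreover have "integrable R (F \<gamma>)"
      using borel_measurable_continuous_on_prob_measures[OF R contF[OF \<gamma>]] ae
      by (intro integrable_const_bound[where B=M]) auto
    ultimately show "- M \<le> cost c R Q \<gamma>"
      unfolding cost_eq by (intro integral_ge_const) (auto elim!: eventually_mono)
  qed
  show ?thesis
  proof (rule tendstoI)
    fix e :: real assume "0 < e"
    \<comment> \<open>The comparison of infima yields only a weak inequality; halving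
      \<open>e\<close> makes it strict.\<close>
    then have "\<forall>\<^sub>F n in sequentially.
        \<forall>f\<in>F ` policies Y U. \<bar>(\<integral>x. f x \<partial>Ps n) - (\<integral>x. f x \<partial>P)\<bar> \<le> e / 2"
      using F_bound
      by (intro weakly_converges_uniform_on_equicontinuous[OF Ps P assms(11) _ equicont, where M=M]) auto
    then show "\<forall>\<^sub>F n in sequentially. dist (opt_cost Y U c (Ps n) Q) (opt_cost Y U c P Q) < e"
    proof eventually_elim
      case (elim n)
      then have "\<bar>opt_cost Y U c (Ps n) Q - opt_cost Y U c P Q\<bar> \<le> e / 2"
        unfolding opt_cost_def using False cost_bdd Ps P
        by (intro abs_diff_cINF_le) (auto simp: cost_eq)
      then show ?case using \<open>0 < e\<close> by (simp add: dist_real_def)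
    qed
  qed
qed

end
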